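(* Let $P_1,\dots,P_n\in\mathbb{R}^2$ ($n\ge 2$) be distinct demand points with weights $w_1,\dots,w_n>0$, let $H$ be their convex hull, and let $X^*$ be an optimal solution of the single weighted obnoxious facility location problem $\max_{X\in H}\ \min_{1\le i\le n} w_i\|X-P_i\|$. Then either $X^*$ is an intersection point of a side of $H$ and an Apollonius circle $\mathcal{A}_{ij}$ for some $i\neq j$, or $X^*$ is an interior point of $H$ at the intersection of two Apollonius circles with a common vertex, i.e. $X^*\in\mathcal{A}_{ij}\cap\mathcal{A}_{ik}$ for some pairwise distinct indices $i,j,k$.
   Context: $\|\cdot\|$ is the Euclidean norm on $\mathbb{R}^2$. For distinct points $P_i,P_j$ with weights $w_i,w_j>0$, the Apollonius circle based on $P_i$ and $P_j$ is $\mathcal{A}_{ij}=\{X\in\mathbb{R}^2: w_i\|X-P_i\|=w_j\|X-P_j\|\}$; it is a genuine circle if $w_i\neq w_j$ and the perpendicular bisector of $P_iP_j$ (a circle of infinite radius) if $w_i=w_j$. Two Apollonius circles have a common vertex if the two pairs of demand points on which they are based are different and share one demand point. Interior and boundary of $H$ are taken in $\mathbb{R}^2$; a side of $H$ is a maximal closed line segment contained in the boundary of $H$. *)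

theory Defs
  imports "HOL-Analysis.Analysis"
begin

text \<open>Demand points and weights are families indexed by \<open>{1..n}\<close>.\<close>

definition apollonius_circle :: "(nat \<Rightarrow> real^2) \<Rightarrow> (nat \<Rightarrow> real) \<Rightarrow> nat \<Rightarrow> nat \<Rightarrow> (real^2) set" where
  "apollonius_circle P w i j = {X. w i * norm (X - P i) = w j * norm (X - P j)}"

definition min_weighted_dist :: "nat \<Rightarrow> (nat \<Rightarrow> real^2) \<Rightarrow> (nat \<Rightarrow> real) \<Rightarrow> real^2 \<Rightarrow> real" where
  "min_weighted_dist n P w X = Min ((\<lambda>i. w i * norm (X - P i)) ` {1..n})"

definition demand_hull :: "nat \<Rightarrow> (nat \<Rightarrow> real^2) \<Rightarrow> (real^2) set" where
  "demand_hull n P = convex hull (P ` {1..n})"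

definition obnoxious_optimal :: "nat \<Rightarrow> (nat \<Rightarrow> real^2) \<Rightarrow> (nat \<Rightarrow> real) \<Rightarrow> real^2 \<Rightarrow> bool" where
  "obnoxious_optimal n P w X \<longleftrightarrow>
     is_arg_max (min_weighted_dist n P w) (\<lambda>Y. Y \<in> demand_hull n P) X"

text \<open>
  The boundary is the topological one in the plane. Hence, if the demand points are collinear,
  the hull is its own boundary and the hull itself is its only side (not a \<open>facet_of\<close> it).
\<close>
definition side_of :: "(real^2) set \<Rightarrow> (real^2) set \<Rightarrow> bool" where
  "side_of S H \<longleftrightarrow>
     (\<exists>a b. a \<noteq> b \<and> S = closed_segment a b) \<and> S \<subseteq> frontier H \<and>
     (\<forall>c d. S \<subseteq> closed_segment c d \<and> closed_segment c d \<subseteq> frontier H \<longrightarrow> closed_segment c d = S)"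

end

theory Submission
  imports Defs
begin

text \<open>
  If every demand point active at \<open>X\<close> makes a non-obtuse angle with a feasible step, a short step in
  that direction increases all active distances, because of the quadratic term in
  \<open>\<parallel>u + t d\<parallel>\<^sup>2 = \<parallel>u\<parallel>\<^sup>2 + 2 t (u \<bullet> d) + t\<^sup>2 \<parallel>d\<parallel>\<^sup>2\<close> even if the angle is right. So at an optimum every
  feasible direction is blocked by an active demand point. Hence \<open>X\<close> is not a vertex of the hull, and
  two opposite feasible directions are blocked by two different active points \<open>i\<close>, \<open>j\<close>. In the
  interior, the direction orthogonal to \<open>X - P\<^sub>i\<close> pointing away from \<open>P\<^sub>j\<close> is blocked by a third one.
  On the boundary, \<open>X\<close> lies inside a segment of the hull, which spans a side.
\<close>

text \<open>The side is the face that a supporting line at \<open>X\<close> cuts out of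
  \<open>H\<close>. Being compact, convex and collinear, it is a segment, and the points around
  \<open>X\<close> keep it from degenerating to a point.\<close>

lemma side_of_through_non_extreme_point:
  fixes H :: "(real^2) set"
  assumes H: "compact H" "convex H"
    and X: "X \<in> frontier H"
    and ab: "a \<in> H" "b \<in> H" "X \<in> open_segment a b"
  obtains S where "side_of S H" "X \<in> S"
proof -
  have clH: "closed H" using H(1) compact_imp_closed by blast
  have XH: "X \<in> H" using X clH by (metis frontier_subset_closed subsetD)
  obtain c where c: "c \<noteq> 0" "\<And>y. y \<in> H \<Longrightarrow> c \<bullet> X \<le> c \<bullet> y"
  \<comment> \<open>A hull without interior lies in a line, and the normal of that line supports it
    everywhere, with equality. Otherwise \<open>X\<close> is on the relative boundary and a proper
    supporting line exists.\<close>
  proof (cases "interior H = {}")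
    case True
    with H(2) obtain c r where "c \<noteq> 0" "H \<subseteq> {x. c \<bullet> x = r}"
      using empty_interior_subset_hyperplane by blast
    have "c \<bullet> y = r" if "y \<in> H" for y
      using \<open>H \<subseteq> {x. c \<bullet> x = r}\<close> that by blast
    with XH have "c \<bullet> X \<le> c \<bullet> y" if "y \<in> H" for y using that by simp
    with \<open>c \<noteq> 0\<close> show thesis by (rule that)
  next
    case False
    then have "X \<notin> rel_interior H"
      using X by (simp add: frontier_def rel_interior_nonempty_interior)
    with that show thesis
      using supporting_hyperplane_rel_boundary[OF H(2) XH] by metis
  qed
  define S where "S = H \<inter> {y. c \<bullet> y = c \<bullet> X}"
  have "aff_dim S \<le> aff_dim {y. c \<bullet> y = c \<bullet> X}"
    unfolding S_def by (intro aff_dim_subset) auto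
  then have "collinear S" using c(1) by (simp add: collinear_aff_dim)
  moreover have "compact S" "convex S"
    unfolding S_def using H by (auto intro!: compact_Int_closed convex_Int closed_hyperplane convex_hyperplane)
  moreover have XS: "X \<in> S" using XH by (simp add: S_def)
  ultimately obtain p q where pq: "S = closed_segment p q"
    using compact_convex_collinear_segment[of S] by blast
  \<comment> \<open>A face that meets the open segment from \<open>a\<close> to \<open>b\<close>
    contains both ends, so \<open>S\<close> has two distinct points.\<close>
  have "S face_of H"
    unfolding S_def using H(2) c(2) by (rule face_of_Int_supporting_hyperplane_ge)
  then have "a \<in> S" "b \<in> S" using ab XS by (meson face_ofD)+
  moreover have "a \<noteq> b" using ab(3) by auto
  ultimately have "p \<noteq> q" using pq by auto
  have front: "S \<subseteq> frontier H"
  proof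
    fix y assume y: "y \<in> S"
    \<comment> \<open>Interior points of \<open>H\<close> satisfy the supporting inequality
      strictly, whereas equality holds on \<open>S\<close>.\<close>
    have "y \<notin> interior H"
    proof
      assume "y \<in> interior H"
      then have "y \<in> interior {x. c \<bullet> X \<le> c \<bullet> x}"
        using c(2) interior_mono[of H "{x. c \<bullet> X \<le> c \<bullet> x}"] by auto
      with y c(1) show False
        using interior_halfspace_ge[of c "c \<bullet> X"] by (simp add: S_def)
    qed
    with y clH show "y \<in> frontier H" by (simp add: frontier_def S_def)
  qed
  \<comment> \<open>Maximality: the linear form \<open>c\<close> agrees at the two distinct points
    \<open>p\<close>, \<open>q\<close> of the longer segment, so it is constant there, and the ends
    \<open>d\<close>, \<open>e\<close> already lie in \<open>S\<close>.\<close>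
  have "closed_segment d e = S" if sub: "S \<subseteq> closed_segment d e" "closed_segment d e \<subseteq> frontier H" for d e
  proof -
    have "p \<in> closed_segment d e" "q \<in> closed_segment d e" using sub(1) pq by auto
    then obtain r s where r: "p = (1 - r) *\<^sub>R d + r *\<^sub>R e" and s: "q = (1 - s) *\<^sub>R d + s *\<^sub>R e"
      by (auto simp: in_segment)
    have "p \<in> S" "q \<in> S" by (simp_all add: pq)
    then have cp: "c \<bullet> p = c \<bullet> X" and cq: "c \<bullet> q = c \<bullet> X"
      by (simp_all add: S_def)
    have "(r - s) * (c \<bullet> e - c \<bullet> d) = 0"
      using cp cq unfolding r s by (simp add: inner_simps algebra_simps)
    moreover have "r \<noteq> s" using r s \<open>p \<noteq> q\<close> by auto
    ultimately have "c \<bullet> e = c \<bullet> d" by simp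
    with cp have "c \<bullet> d = c \<bullet> X" "c \<bullet> e = c \<bullet> X"
      unfolding r by (simp_all add: inner_simps algebra_simps)
    moreover have "d \<in> H" "e \<in> H"
      using sub(2) clH by (meson ends_in_segment frontier_subset_closed subsetD)+
    ultimately have "d \<in> S" "e \<in> S" by (simp_all add: S_def)
    with \<open>convex S\<close> have "closed_segment d e \<subseteq> S" by (simp add: closed_segment_subset)
    with sub(1) show ?thesis by blast
  qed
  with front pq \<open>p \<noteq> q\<close> have "side_of S H" unfolding side_of_def by blast
  with XS show thesis using that by blast
qed

lemma norm_add_scaleR_gt:
  fixes u d :: "'a::real_inner"
  assumes "u \<bullet> d \<ge> 0" "d \<noteq> 0" "t > 0"
  shows "norm (u + t *\<^sub>R d) > norm u"
proof (rule power2_less_imp_less)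
  have "(norm (u + t *\<^sub>R d))\<^sup>2 = (norm u)\<^sup>2 + 2 * t * (u \<bullet> d) + (t * norm d)\<^sup>2"
    by (simp add: power2_norm_eq_inner inner_simps inner_commute power_mult_distrib)
       (simp add: algebra_simps power2_eq_square)
  then show "(norm u)\<^sup>2 < (norm (u + t *\<^sub>R d))\<^sup>2"
    using assms by (simp add: add_nonneg_pos)
qed simp

lemma min_weighted_dist_le:
  "i \<in> {1..n} \<Longrightarrow> min_weighted_dist n P w X \<le> w i * norm (X - P i)"
  unfolding min_weighted_dist_def by (rule Min_le) auto

lemma obnoxious_optimal_blocking:
  assumes "n \<ge> 1" and w: "\<And>i. i \<in> {1..n} \<Longrightarrow> w i > 0"
    and opt: "obnoxious_optimal n P w X"
    and Y: "Y \<in> demand_hull n P" "Y \<noteq> X"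
  obtains i where "i \<in> {1..n}" "w i * norm (X - P i) = min_weighted_dist n P w X"
    "(X - P i) \<bullet> (Y - X) < 0"
proof (rule ccontr)
  note block = that
  assume no_block: "\<not> thesis"
  define m where "m = min_weighted_dist n P w X"
  define Z where "Z = (\<lambda>t. X + t *\<^sub>R (Y - X))"
  have nb: "(X - P i) \<bullet> (Y - X) \<ge> 0" if "i \<in> {1..n}" "w i * norm (X - P i) = m" for i
    using that(1,2) no_block block[of i] unfolding m_def by (meson not_le)
  have X: "X \<in> demand_hull n P"
    and max: "\<not> min_weighted_dist n P w V > m" if "V \<in> demand_hull n P" for V
    using opt that by (auto simp: obnoxious_optimal_def is_arg_max_def m_def)
  have "\<forall>\<^sub>F t in at_right 0. m < w i * norm (Z t - P i)" if i: "i \<in> {1..n}" for i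
  \<comment> \<open>Unblocked active distances grow for every t > 0. Inactive ones exceed
    \<open>m\<close> strictly at t = 0 and stay above it by continuity. As there are finitely many,
    one small t serves all.\<close>
  proof (cases "w i * norm (X - P i) = m")
    case True
    show ?thesis
      using eventually_at_right_less
    proof eventually_elim
      case (elim t)
      have "norm (X - P i) < norm (X - P i + t *\<^sub>R (Y - X))"
        using nb[OF i True] Y(2) elim by (intro norm_add_scaleR_gt) auto
      then show ?case
        using w[OF i] unfolding True[symmetric] Z_def by (simp add: algebra_simps)
    qed
  next
    case False
    then have "m < w i * norm (Z 0 - P i)"
      using min_weighted_dist_le[OF i, of P w X] by (simp add: Z_def m_def)
    moreover have "((\<lambda>t. w i * norm (Z t - P i)) \<longlongrightarrow> w i * norm (Z 0 - P i)) (at_right 0)"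
      unfolding Z_def by (intro tendsto_intros)
    ultimately show ?thesis by (rule order_tendstoD(1)[rotated])
  qed
  then have "\<forall>\<^sub>F t in at_right 0. \<forall>i\<in>{1..n}. m < w i * norm (Z t - P i)"
    by (intro eventually_ball_finite) auto
  moreover have "\<forall>\<^sub>F t::real in at_right 0. t \<in> {0<..<1}"
    by (rule eventually_at_right_real) simp
  ultimately have "\<forall>\<^sub>F t in at_right 0. (\<forall>i\<in>{1..n}. m < w i * norm (Z t - P i)) \<and> t \<in> {0<..<1}"
    by (rule eventually_conj)
  then obtain t where t: "\<forall>i\<in>{1..n}. m < w i * norm (Z t - P i)" "0 < t" "t < 1"
    using eventually_happens by force
  have "Z t = (1 - t) *\<^sub>R X + t *\<^sub>R Y" by (simp add: Z_def algebra_simps)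
  then have "Z t \<in> demand_hull n P"
    using X Y(1) t convex_convex_hull[of "P ` {1..n}"]
    unfolding demand_hull_def by (simp add: convex_alt)
  moreover have "min_weighted_dist n P w (Z t) > m"
    using t(1) \<open>n \<ge> 1\<close> unfolding min_weighted_dist_def by (subst Min_gr_iff) auto
  ultimately show False using max by blast
qed

text \<open>An extreme point of the hull is a demand point, so the minimal weighted distance there
  is 0. Every active point then coincides with \<open>X\<close>, and the zero vector
  \<open>X - P i\<close> blocks no step towards another demand point.\<close>

lemma obnoxious_optimal_not_extreme:
  assumes n: "n \<ge> 2" and inj: "inj_on P {1..n}"
    and w: "\<And>i. i \<in> {1..n} \<Longrightarrow> w i > 0"
    and opt: "obnoxious_optimal n P w X"
  shows "\<not> X extreme_point_of demand_hull n P"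
proof
  assume "X extreme_point_of demand_hull n P"
  then obtain k where k: "k \<in> {1..n}" "X = P k"
    unfolding demand_hull_def using extreme_point_of_convex_hull by blast
  have "\<exists>l\<in>{1..n}. l \<noteq> k"
    using n by (intro bexI[of _ "if k = 1 then 2 else 1"]) auto
  then obtain l where l: "l \<in> {1..n}" "l \<noteq> k" by blast
  have "P l \<in> demand_hull n P"
    unfolding demand_hull_def using l(1) by (simp add: hull_inc)
  moreover have "P l \<noteq> X" using inj k l by (metis inj_onD)
  ultimately obtain i where i: "i \<in> {1..n}" "w i * norm (X - P i) = min_weighted_dist n P w X"
    "(X - P i) \<bullet> (P l - X) < 0"
    using obnoxious_optimal_blocking[OF _ w opt] n by (metis one_le_numeral order_trans)
  have "w i * norm (X - P i) \<le> 0"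
    using min_weighted_dist_le[OF k(1), of P w X] k(2) i(2) by simp
  then have "X - P i = 0" using w[OF i(1)] by (simp add: mult_le_0_iff)
  with i(3) show False by simp
qed

theorem theorem5:
  fixes n :: nat and P :: "nat \<Rightarrow> real^2" and w :: "nat \<Rightarrow> real" and X :: "real^2"
  assumes "n \<ge> 2"
    and "inj_on P {1..n}"
    and "\<And>i. i \<in> {1..n} \<Longrightarrow> w i > 0"
    and "obnoxious_optimal n P w X"
  shows "(\<exists>S i j. side_of S (demand_hull n P) \<and> i \<in> {1..n} \<and> j \<in> {1..n} \<and> i \<noteq> j \<and>
            X \<in> S \<inter> apollonius_circle P w i j)
       \<or> (X \<in> interior (demand_hull n P) \<and>
          (\<exists>i j k. i \<in> {1..n} \<and> j \<in> {1..n} \<and> k \<in> {1..n} \<and> i \<noteq> j \<and> i \<noteq> k \<and> j \<noteq> k \<and>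
            X \<in> apollonius_circle P w i j \<inter> apollonius_circle P w i k))"
proof -
  let ?H = "demand_hull n P"
  let ?active = "\<lambda>i. i \<in> {1..n} \<and> w i * norm (X - P i) = min_weighted_dist n P w X"
  have circle: "X \<in> apollonius_circle P w i j" if "?active i" "?active j" for i j
    using that by (simp add: apollonius_circle_def)
  have blocking: "\<exists>i. ?active i \<and> (X - P i) \<bullet> (Y - X) < 0" if "Y \<in> ?H" "Y \<noteq> X" for Y
    using obnoxious_optimal_blocking[OF _ assms(3,4) that] assms(1)
    by (metis one_le_numeral order_trans)
  have H: "compact ?H" "convex ?H"
    unfolding demand_hull_def by (simp_all add: finite_imp_compact_convex_hull)
  have XH: "X \<in> ?H" using assms(4) by (simp add: obnoxious_optimal_def is_arg_max_def)
  then obtain a b where ab: "a \<in> ?H" "b \<in> ?H" "X \<in> open_segment a b"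
    using obnoxious_optimal_not_extreme[OF assms] by (auto simp: extreme_point_of_def)
  then obtain t where t: "0 < t" "t < 1" "X = (1 - t) *\<^sub>R a + t *\<^sub>R b" and "a \<noteq> b"
    by (auto simp: in_segment)
  \<comment> \<open>Both steps are positive multiples of opposite vectors, so no single demand point
    can block both.\<close>
  have steps: "a - X = t *\<^sub>R (a - b)" "b - X = (1 - t) *\<^sub>R (b - a)"
    unfolding t(3) by (simp_all add: algebra_simps)
  have "a \<noteq> X" "b \<noteq> X" using steps t(1,2) \<open>a \<noteq> b\<close> by auto
  then obtain i j where i: "?active i" "(X - P i) \<bullet> (a - X) < 0"
    and j: "?active j" "(X - P j) \<bullet> (b - X) < 0"
    using blocking ab(1,2) by meson
  have "i \<noteq> j"
  proof
    assume "i = j"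
    then have "(X - P i) \<bullet> (a - b) < 0" "(X - P i) \<bullet> (b - a) < 0"
      using i(2) j(2) t(1,2) unfolding steps by (auto simp: mult_less_0_iff)
    then show False by (simp add: inner_diff_right)
  qed
  show ?thesis
  proof (cases "X \<in> interior ?H")
    case False
    with XH have "X \<in> frontier ?H" using closure_subset by (auto simp: frontier_def)
    with side_of_through_non_extreme_point[OF H _ ab] obtain S where "side_of S ?H" "X \<in> S" by blast
    with i(1) j(1) \<open>i \<noteq> j\<close> circle show ?thesis by blast
  next
    case True
    obtain d0 where d0: "d0 \<noteq> 0" "(X - P i) \<bullet> d0 = 0"
      using orthogonal_to_vector_exists[of "X - P i"] by (auto simp: orthogonal_def)
    \<comment> \<open>The sign is chosen so that \<open>P j\<close> does not block \<open>d\<close>;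
      orthogonality already rules out \<open>P i\<close>.\<close>
    define d where "d = (if (X - P j) \<bullet> d0 \<ge> 0 then d0 else - d0)"
    have d: "d \<noteq> 0" "(X - P i) \<bullet> d = 0" "(X - P j) \<bullet> d \<ge> 0"
      using d0 by (auto simp: d_def)
    obtain e where e: "e > 0" "cball X e \<subseteq> ?H" using True by (auto simp: mem_interior_cball)
    \<comment> \<open>Rescaling to length \<open>e\<close> keeps the step inside the ball around
      \<open>X\<close> contained in the hull.\<close>
    define Y where "Y = X + (e / norm d) *\<^sub>R d"
    have "Y \<in> ?H" using e d(1) by (intro subsetD[OF e(2)]) (simp add: Y_def dist_norm)
    moreover have "Y \<noteq> X" using e(1) d(1) by (simp add: Y_def)
    ultimately obtain k where k: "?active k" "(X - P k) \<bullet> (Y - X) < 0" using blocking by blast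
    then have "(X - P k) \<bullet> d < 0" using e(1) d(1) by (simp add: Y_def divide_less_0_iff mult_less_0_iff)
    with d(2,3) have "k \<noteq> i" "k \<noteq> j" by auto
    with True i(1) j(1) k(1) \<open>i \<noteq> j\<close> circle show ?thesis by blast
  qed
qed

end
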